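(* Suppose $\liminf \rho_{ij}=\delta>0$. Then, for any $\alpha \in (0,1)$ and any positive integer $k$ satisfying $k\alpha <1$, $$\lim_{n \to \infty}k\text{-}FWER(n,\alpha,\mathbf{\Sigma}_{n}) = 0.$$
   Context: Let $\Phi$ denote the cumulative distribution function of the standard normal distribution. Consider a sequence $X_1,X_2,\ldots$ of jointly normal random variables with $X_i\sim\mathcal{N}(\mu_i,1)$ and $\operatorname{Corr}(X_i,X_j)=\rho_{ij}$ for $i\neq j$, where $\rho_{ij}\in(0,1]$. Let $\mathbf{\Sigma}_n$ be the correlation matrix of $(X_1,\ldots,X_n)$. Here $\liminf\rho_{ij}$ means the limit inferior over $i\ne j$ as $i,j\to\infty$, i.e. $\lim_{N\to\infty}\inf\{\rho_{ij}: i,j\ge N,\ i\neq j\}$. The null hypotheses are $H_{0i}:\mu_i=0$, and for each $n$ the global (intersection) null is $H_0=\bigcap_{i=1}^n H_{0i}$, under which $(X_1,\ldots,X_n)\sim N_n(\mathbf{0},\mathbf{\Sigma}_n)$ (possibly degenerate). The $k$-FWER is the probability of rejecting at least $k$ true null hypotheses. For the procedure that rejects $H_{0i}$ if $X_i>\Phi^{-1}(1-k\alpha/n)$ it is $$k\text{-}FWER(n,\alpha,\mathbf{\Sigma}_n)=\mathbb{P}_{H_0}\big(X_i>\Phi^{-1}(1-k\alpha/n)\ \text{for at least } k \text{ indices } i\in\{1,\ldots,n\}\big).$$ *)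

theory Defs
  imports "HOL-Probability.Probability"
begin

definition Phi :: "real \<Rightarrow> real" where
  "Phi = cdf std_normal_distribution"

definition covariance :: "'a measure \<Rightarrow> ('a \<Rightarrow> real) \<Rightarrow> ('a \<Rightarrow> real) \<Rightarrow> real" where
  "covariance M X Y =
     (LINT w|M. (X w - (LINT v|M. X v)) * (Y w - (LINT v|M. Y v)))"

definition correlation :: "'a measure \<Rightarrow> ('a \<Rightarrow> real) \<Rightarrow> ('a \<Rightarrow> real) \<Rightarrow> real" where
  "correlation M X Y =
     covariance M X Y / (sqrt (covariance M X X) * sqrt (covariance M Y Y))"

(* The law N(m, s^2); the degenerate case s = 0 is the point mass at m, because
   normal_density m 0 is the zero function. *)
definition normal_law :: "real \<Rightarrow> real \<Rightarrow> real measure" where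
  "normal_law m s =
     (if s = 0 then return borel m else density lborel (\<lambda>x. ennreal (normal_density m s x)))"

(* Possibly degenerate, and I may be infinite: every finite linear combination is normal. *)
definition jointly_normal :: "'a measure \<Rightarrow> 'i set \<Rightarrow> ('i \<Rightarrow> 'a \<Rightarrow> real) \<Rightarrow> bool" where
  "jointly_normal M I X \<longleftrightarrow>
     (\<forall>i\<in>I. X i \<in> borel_measurable M) \<and>
     (\<forall>J a. finite J \<and> J \<subseteq> I \<longrightarrow>
        (\<exists>m s. 0 \<le> s \<and> distr M borel (\<lambda>w. \<Sum>i\<in>J. a i * X i w) = normal_law m s))"

(* N is the law N_n(0, S) on real n-tuples. The tuples are functions on {1..n}, and
   only the entries S i j with i, j in {1..n} are relevant. *)
definition centered_normal_law ::
    "nat \<Rightarrow> (nat \<Rightarrow> nat \<Rightarrow> real) \<Rightarrow> (nat \<Rightarrow> real) measure \<Rightarrow> bool" where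
  "centered_normal_law n S N \<longleftrightarrow>
     prob_space N \<and>
     sets N = sets (PiM {1..n} (\<lambda>_. borel :: real measure)) \<and>
     jointly_normal N {1..n} (\<lambda>i x. x i) \<and>
     (\<forall>i\<in>{1..n}. (LINT x|N. x i) = 0) \<and>
     (\<forall>i\<in>{1..n}. \<forall>j\<in>{1..n}. covariance N (\<lambda>x. x i) (\<lambda>x. x j) = S i j)"

(* If S is a covariance matrix (symmetric, positive semidefinite), exactly one law satisfies
   the predicate, by the Cramer-Wold theorem, so the choice operator selects N_n(0, S). *)
definition mvn0 :: "nat \<Rightarrow> (nat \<Rightarrow> nat \<Rightarrow> real) \<Rightarrow> (nat \<Rightarrow> real) measure" where
  "mvn0 n S = (SOME N. centered_normal_law n S N)"

definition kFWER :: "nat \<Rightarrow> nat \<Rightarrow> real \<Rightarrow> (nat \<Rightarrow> nat \<Rightarrow> real) \<Rightarrow> real" where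
  "kFWER k n \<alpha> S =
     measure (mvn0 n S)
       {x \<in> space (mvn0 n S).
          k \<le> card {i \<in> {1..n}. x i > inv Phi (1 - real k * \<alpha> / real n)}}"

end

theory Submission
  imports Defs
begin

text \<open>
  Having \<open>k \<ge> 1\<close> rejections means in particular that the maximum exceeds the threshold \<open>c\<close>, and \<open>c\<close> is
  chosen such that \<open>n * P(Z > c) = k * \<alpha>\<close> for a standard normal \<open>Z\<close>; hence \<open>c\<close> tends to infinity.
  Fix \<open>0 < d < \<delta>\<close> and \<open>p\<close> with \<open>\<rho> i j > d\<close> for all distinct \<open>i, j \<ge> p\<close>. No comparison inequality of
  Slepian type is needed: for \<open>i > p\<close> the variable \<open>X i - d * X p\<close> has variance
  \<open>1 - 2 * d * \<rho> i p + d\<^sup>2 \<le> 1 - d\<^sup>2 < 1\<close>. If \<open>X i > c\<close>, then \<open>d * X p > \<eta> * c\<close> or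
  \<open>X i - d * X p > (1 - \<eta>) * c\<close>. The first event does not depend on \<open>i\<close>, and its probability tends to 0. For small \<open>\<eta>\<close> the second one
  has probability at most \<open>P(Z > r * c)\<close> with \<open>r > 1\<close>, which is \<open>o(P(Z > c)) = o(1 / n)\<close>, so a union
  bound over \<open>i\<close> suffices.
\<close>

section \<open>Univariate normal laws as affine images of the standard normal law\<close>

lemma prob_space_std_normal: "prob_space std_normal_distribution"
  using prob_space_normal_density[of 1 0] by simp

text \<open>Since \<open>s = 0\<close> is covered by the constant map, later arguments about
  \<open>normal_law\<close> can work with \<open>m + s * Z\<close> for a standard normal
  \<open>Z\<close> and need no separate degenerate case.\<close>

lemma normal_law_eq_distr:
  assumes "0 \<le> s"
  shows "normal_law m s = distr std_normal_distribution borel (\<lambda>x. m + s * x)"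
proof (cases "s = 0")
  case True
  then show ?thesis
    using prob_space.distr_const[OF prob_space_std_normal, of m borel]
    by (simp add: normal_law_def)
next
  case False
  interpret prob_space std_normal_distribution by (rule prob_space_std_normal)
  \<comment> \<open>The affine rule for normal densities speaks of random variables, so the identity
    map serves as a standard normal variable on the standard normal space itself.\<close>
  have "distributed std_normal_distribution lborel (\<lambda>x. x) std_normal_density"
    by (auto simp: distributed_def intro!: measure_eqI)
       (simp add: emeasure_distr)
  from normal_density_affine[OF this, of s m] False assms
  have "distributed std_normal_distribution lborel (\<lambda>x. m + s * x) (normal_density m s)"
    by simp
  then have "distr std_normal_distribution lborel (\<lambda>x. m + s * x) = density lborel (normal_density m s)"
    by (simp add: distributed_def)
  moreover have "distr std_normal_distribution lborel (\<lambda>x. m + s * x)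
      = distr std_normal_distribution borel (\<lambda>x. m + s * x)"
    by (rule distr_cong) auto
  ultimately show ?thesis
    using False by (simp add: normal_law_def)
qed

lemma normal_law_shift:
  assumes "0 \<le> s"
  shows "distr (normal_law m s) borel (\<lambda>y. y - C) = normal_law (m - C) s"
  unfolding normal_law_eq_distr[OF assms]
  by (subst distr_distr) (auto simp: comp_def algebra_simps)

text \<open>Joint normality only asserts that some parameters \<open>m\<close> and \<open>s\<close>
  exist. Substituting \<open>m + s * Z\<close> and using the first two moments of \<open>Z\<close>
  identifies them as mean and standard deviation, so they can later be computed from means and
  covariances.\<close>

lemma
  fixes Y :: "'a \<Rightarrow> real"
  assumes Y [measurable]: "Y \<in> borel_measurable N"
    and law: "distr N borel Y = normal_law m s" and s: "0 \<le> s"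
  shows normal_law_integrable: "integrable N Y"
    and normal_law_integrable_square: "integrable N (\<lambda>x. (Y x)\<^sup>2)"
    and normal_law_mean: "(LINT x|N. Y x) = m"
    and normal_law_variance: "(LINT x|N. (Y x - m)\<^sup>2) = s\<^sup>2"
proof -
  let ?S = std_normal_distribution
  interpret S: prob_space ?S by (rule prob_space_std_normal)
  have law': "distr N borel Y = distr ?S borel (\<lambda>x. m + s * x)"
    using law normal_law_eq_distr[OF s] by simp
  have int: "integrable N (\<lambda>x. f (Y x)) \<longleftrightarrow> integrable ?S (\<lambda>x. f (m + s * x))"
    and eq: "(LINT x|N. f (Y x)) = (LINT x|?S. f (m + s * x))"
    if [measurable]: "f \<in> borel_measurable borel" for f :: "real \<Rightarrow> real"
    using integrable_distr_eq[OF Y that] integral_distr[OF Y that]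
      integrable_distr_eq[of "\<lambda>x. m + s * x" ?S borel f] integral_distr[of "\<lambda>x. m + s * x" ?S borel f]
    unfolding law' by auto
  have i1: "integrable ?S (\<lambda>x. x)" and i2: "integrable ?S (\<lambda>x. x\<^sup>2)"
    using integrable_std_normal_distribution_moment[of 1] integrable_std_normal_distribution_moment[of 2]
    by simp_all
  have e1: "(LINT x|?S. x) = 0" and e2: "(LINT x|?S. x\<^sup>2) = 1"
    using integral_std_normal_distribution_moment_odd[of 1] std_normal_distribution_even_moments(1)[of 1]
    by simp_all
  have i3: "integrable ?S (\<lambda>x. m + s * x)"
    by (intro Bochner_Integration.integrable_add integrable_mult_right i1) simp
  have i4: "integrable ?S (\<lambda>x. m\<^sup>2 + (2 * m * s) * x + s\<^sup>2 * x\<^sup>2)"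
    by (intro Bochner_Integration.integrable_add integrable_mult_right i1 i2) simp
  have sq: "(m + s * x)\<^sup>2 = m\<^sup>2 + (2 * m * s) * x + s\<^sup>2 * x\<^sup>2" for x
    by (simp add: power2_sum power_mult_distrib)
  show "integrable N Y"
    by (rule int[THEN iffD2, OF _ i3]) simp
  have "integrable N (\<lambda>x. (\<lambda>y. y\<^sup>2) (Y x))"
    by (rule int[THEN iffD2]) (simp, unfold sq, rule i4)
  then show "integrable N (\<lambda>x. (Y x)\<^sup>2)" .
  have "(LINT x|N. Y x) = (LINT x|?S. m + s * x)"
    by (rule eq) simp
  also have "\<dots> = m"
    by (subst Bochner_Integration.integral_add) (use S.prob_space in \<open>simp_all add: i1 e1\<close>)
  finally show "(LINT x|N. Y x) = m" .
  have "(LINT x|N. (Y x - m)\<^sup>2) = (LINT x|?S. (m + s * x - m)\<^sup>2)"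
    by (rule eq[of "\<lambda>y. (y - m)\<^sup>2"]) simp
  also have "\<dots> = (LINT x|?S. s\<^sup>2 * x\<^sup>2)"
    by (simp add: power_mult_distrib)
  also have "\<dots> = s\<^sup>2"
    using e2 by (subst integral_mult_right_zero) simp
  finally show "(LINT x|N. (Y x - m)\<^sup>2) = s\<^sup>2" .
qed

section \<open>Tails and quantiles of the standard normal law\<close>

definition normal_tail :: "real \<Rightarrow> real" where
  "normal_tail c = measure std_normal_distribution {c<..}"

lemma normal_tail_eq: "normal_tail c = 1 - Phi c"
proof -
  interpret real_distribution std_normal_distribution by (rule real_dist_normal_dist)
  have "{c<..} = UNIV - {..c}" by auto
  then show ?thesis
    using prob_compl[of "{..c}"] by (simp add: normal_tail_def Phi_def cdf_def)
qed

lemma normal_tail_antimono: "a \<le> b \<Longrightarrow> normal_tail b \<le> normal_tail a"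
proof -
  interpret real_distribution std_normal_distribution by (rule real_dist_normal_dist)
  show "a \<le> b \<Longrightarrow> normal_tail b \<le> normal_tail a"
    unfolding normal_tail_def by (rule finite_measure_mono) auto
qed

lemma normal_tail_tendsto_0: "(normal_tail \<longlongrightarrow> 0) at_top"
proof -
  interpret real_distribution std_normal_distribution by (rule real_dist_normal_dist)
  show ?thesis
    unfolding normal_tail_eq[abs_def] Phi_def
    using tendsto_diff[OF tendsto_const cdf_lim_at_top_prob, of 1] by simp
qed

text \<open>The density is strictly positive, so a half-line of mass zero would be Lebesgue null,
  although it contains an interval of length 1. Positivity is what later makes \<open>q / n\<close>
  drop below any given tail value.\<close>

lemma normal_tail_pos: "0 < normal_tail c"
proof (rule ccontr)
  interpret real_distribution std_normal_distribution by (rule real_dist_normal_dist)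
  assume "\<not> 0 < normal_tail c"
  then have "measure std_normal_distribution {c<..} = 0"
    by (simp add: normal_tail_def order.antisym)
  then have "emeasure std_normal_distribution {c<..} = 0"
    by (simp add: emeasure_eq_measure)
  then have "AE x in std_normal_distribution. x \<notin> {c<..}"
    by (intro AE_not_in) (auto simp: null_sets_def)
  then have "AE x in lborel. x \<notin> {c<..}"
    using normal_density_pos[of 1 0] by (subst (asm) AE_density) auto
  then have "emeasure lborel {c<..} = 0"
    by (subst (asm) AE_iff_measurable[OF _ refl]) (auto simp: greaterThan_def)
  moreover have "emeasure lborel {c<..<c+1} \<le> emeasure lborel {c<..}"
    by (intro emeasure_mono) auto
  ultimately show False by simp
qed

text \<open>\<open>Z / r\<close> has a normal density whose ratio to that of \<open>Z\<close> is
  \<open>r * exp (- (r\<^sup>2 - 1) * x\<^sup>2 / 2)\<close>. This ratio decreases for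
  \<open>x \<ge> 0\<close>, so on \<open>x > c\<close> it is at most its value at \<open>c\<close>;
  integrating gives the claim. The two tails are compared directly, without asymptotics for either
  of them.\<close>

lemma normal_tail_scale_le:
  assumes r: "1 < r" and c: "0 \<le> c"
  shows "normal_tail (r * c) \<le> r * exp (- (r\<^sup>2 - 1) * c\<^sup>2 / 2) * normal_tail c"
proof -
  interpret real_distribution std_normal_distribution by (rule real_dist_normal_dist)
  let ?S = std_normal_distribution and ?K = "r * exp (- (r\<^sup>2 - 1) * c\<^sup>2 / 2)"
  have "normal_tail (r * c) = measure (distr ?S borel (\<lambda>x. 0 + (1 / r) * x)) {c<..}"
    unfolding normal_tail_def
    by (subst measure_distr) (use r in \<open>auto intro!: arg_cong[where f="measure _"] simp: field_simps\<close>)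
  also have "\<dots> = measure (density lborel (\<lambda>x. ennreal (normal_density 0 (1/r) x))) {c<..}"
    using normal_law_eq_distr[of "1/r" 0] r by (simp add: normal_law_def)
  finally have eq: "normal_tail (r * c) = measure (density lborel (\<lambda>x. ennreal (normal_density 0 (1/r) x))) {c<..}" .
  have le: "normal_density 0 (1/r) x \<le> ?K * std_normal_density x" if "c < x" for x
  proof -
    have "c\<^sup>2 \<le> x\<^sup>2" using that c by (simp add: power_mono)
    then have "(r\<^sup>2 - 1) * c\<^sup>2 \<le> (r\<^sup>2 - 1) * x\<^sup>2"
      using r by (intro mult_left_mono) auto
    then have "exp (- (r\<^sup>2 * x\<^sup>2) / 2) \<le> exp (- (r\<^sup>2 - 1) * c\<^sup>2 / 2 + - x\<^sup>2 / 2)"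
      by (simp add: algebra_simps)
    then have "r * exp (- (r\<^sup>2 * x\<^sup>2) / 2) / sqrt (2 * pi) \<le> r * exp (- (r\<^sup>2 - 1) * c\<^sup>2 / 2 + - x\<^sup>2 / 2) / sqrt (2 * pi)"
      using r by (intro divide_right_mono mult_left_mono) auto
    then show ?thesis
      using r unfolding normal_density_def exp_add
      by (simp add: power_divide real_sqrt_divide field_simps)
  qed
  have "emeasure (density lborel (\<lambda>x. ennreal (normal_density 0 (1/r) x))) {c<..}
      \<le> (\<integral>\<^sup>+x. ennreal ?K * (ennreal (std_normal_density x) * indicator {c<..} x) \<partial>lborel)"
    by (subst emeasure_density)
       (use le r in \<open>auto intro!: nn_integral_mono simp: indicator_def ennreal_mult[symmetric]\<close>)
  also have "\<dots> = ennreal ?K * emeasure ?S {c<..}"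
    by (simp add: nn_integral_cmult emeasure_density)
  also have "\<dots> = ennreal (?K * normal_tail c)"
    using r by (simp add: emeasure_eq_measure normal_tail_def ennreal_mult)
  finally show ?thesis
    unfolding eq measure_def normal_tail_def[symmetric]
    using r by (intro enn2real_leI) (auto simp: normal_tail_def)
qed

text \<open>The event is rewritten as \<open>c < s * Z\<close> rather than divided by
  \<open>s\<close>, which keeps \<open>s = 0\<close> included. As \<open>c\<close> and
  \<open>s\<close> are nonnegative, the event forces \<open>Z > 0\<close>, and then \<open>s\<close>
  may be replaced by the larger \<open>t\<close>.\<close>

lemma normal_law_prob_gt_le:
  assumes N: "prob_space N" and Y [measurable]: "Y \<in> borel_measurable N"
    and law: "distr N borel Y = normal_law 0 s" and s: "0 \<le> s" "s \<le> t" and t: "0 < t" and c: "0 \<le> c"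
  shows "measure N {x \<in> space N. Y x > c} \<le> normal_tail (c / t)"
proof -
  interpret real_distribution std_normal_distribution by (rule real_dist_normal_dist)
  have "measure N {x \<in> space N. Y x > c} = measure (distr N borel Y) {c<..}"
    by (subst measure_distr) (auto intro!: arg_cong[where f="measure _"])
  also have "\<dots> = measure std_normal_distribution {x. c < s * x}"
    unfolding law normal_law_eq_distr[OF s(1)]
    by (subst measure_distr) (auto intro!: arg_cong[where f="measure _"])
  also have "\<dots> \<le> normal_tail (c / t)"
    unfolding normal_tail_def
  proof (intro finite_measure_mono subsetI)
    fix x assume "x \<in> {x. c < s * x}"
    then have x: "c < s * x" by simp
    with s c have "0 < x"
      by (metis mult_nonneg_nonpos not_le order.strict_trans2 order_less_irrefl)
    with s have "s * x \<le> t * x" by (simp add: mult_right_mono)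
    with x t show "x \<in> {c / t<..}" by (simp add: field_simps)
  qed auto
  finally show ?thesis .
qed

text \<open>\<open>inv\<close> picks some preimage, so it suffices that \<open>y\<close> is in the
  range of \<open>Phi\<close>. The normal law has no atoms, hence \<open>Phi\<close> is continuous;
  its limits are 0 and 1, and the intermediate value theorem applies to every \<open>y\<close>
  strictly between them.\<close>

lemma Phi_inv:
  assumes "0 < y" "y < 1"
  shows "Phi (inv Phi y) = y"
proof -
  interpret real_distribution std_normal_distribution by (rule real_dist_normal_dist)
  have cont: "isCont Phi x" for x
  proof -
    have "emeasure std_normal_distribution {x} = 0"
      by (simp add: emeasure_density nn_integral_indicator_singleton)
    then show ?thesis
      unfolding Phi_def isCont_cdf by (simp add: measure_def)
  qed
  have "eventually (\<lambda>x. Phi x < y) at_bot" "eventually (\<lambda>x. y < Phi x) at_top"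
    unfolding Phi_def using assms order_tendstoD(2)[OF cdf_lim_at_bot]
      order_tendstoD(1)[OF cdf_lim_at_top_prob] by auto
  then obtain a b where ab: "Phi a < y" "y < Phi b"
    by (auto simp: eventually_at_bot_linorder eventually_at_top_linorder)
  then have "a \<le> b"
    using cdf_nondecreasing[of b a] unfolding Phi_def by fastforce
  from IVT[of Phi a y b] ab this cont have "y \<in> range Phi"
    by fastforce
  then show ?thesis by (rule f_inv_into_f)
qed

section \<open>Jointly normal families, centered normal vectors and their maximum\<close>

lemma jointly_normal_lawE:
  assumes "jointly_normal M I X" "finite J" "J \<subseteq> I"
  obtains m s where "0 \<le> s" "distr M borel (\<lambda>w. \<Sum>i\<in>J. a i * X i w) = normal_law m s"
  using assms unfolding jointly_normal_def by blast

lemma jointly_normal_subset: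
  assumes "jointly_normal M I X" "I' \<subseteq> I"
  shows "jointly_normal M I' X"
  using assms unfolding jointly_normal_def by (meson order_trans subsetD)

lemma jointly_normal_marginalE:
  fixes X :: "'i \<Rightarrow> 'a \<Rightarrow> real"
  assumes J: "jointly_normal M I X" and i: "i \<in> I"
  obtains m s where "0 \<le> s" "distr M borel (X i) = normal_law m s"
proof -
  obtain m s where "0 \<le> s" "distr M borel (\<lambda>w. \<Sum>j\<in>{i}. 1 * X j w) = normal_law m s"
    by (rule jointly_normal_lawE[OF J, where J = "{i}" and a = "\<lambda>_. 1"]) (use i in auto)
  then show thesis
    using that by simp
qed

lemma
  fixes X :: "'i \<Rightarrow> 'a \<Rightarrow> real"
  assumes J: "jointly_normal M I X" and i: "i \<in> I"
  shows jointly_normal_integrable: "integrable M (X i)"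
    and jointly_normal_integrable_square: "integrable M (\<lambda>w. (X i w)\<^sup>2)"
proof -
  have X: "X i \<in> borel_measurable M"
    using J i by (simp add: jointly_normal_def)
  obtain m s where s: "0 \<le> s" and law: "distr M borel (X i) = normal_law m s"
    by (rule jointly_normal_marginalE[OF J i])
  show "integrable M (X i)" "integrable M (\<lambda>w. (X i w)\<^sup>2)"
    using normal_law_integrable[OF X law s] normal_law_integrable_square[OF X law s] by auto
qed

text \<open>This supplies the witness that makes the choice in \<open>mvn0\<close> meaningful: the
  centered vector of the given variables. Centering shifts each linear combination by a constant, so
  normality and covariances survive. The map is restricted to \<open>{1..n}\<close> because points
  of the product space are extensional functions.\<close>

lemma centered_normal_law_distr:
  fixes X :: "nat \<Rightarrow> 'a \<Rightarrow> real"
  assumes M: "prob_space M" and J: "jointly_normal M {1..n} X"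
  shows "centered_normal_law n (\<lambda>i j. covariance M (X i) (X j))
    (distr M (PiM {1..n} (\<lambda>_. borel)) (\<lambda>w. \<lambda>i\<in>{1..n}. X i w - (LINT v|M. X i v)))"
proof -
  interpret prob_space M by (rule M)
  define e where "e i = (LINT v|M. X i v)" for i
  let ?P = "PiM {1..n} (\<lambda>_. borel :: real measure)"
  let ?T = "\<lambda>w. \<lambda>i\<in>{1..n}. X i w - e i"
  let ?N = "distr M ?P ?T"
  have X: "X i \<in> borel_measurable M" if "i \<in> {1..n}" for i
    using J that by (simp add: jointly_normal_def)
  have T [measurable]: "?T \<in> M \<rightarrow>\<^sub>M ?P"
    by (intro measurable_restrict borel_measurable_diff X) auto
  have comp: "(\<lambda>x. x i) \<in> borel_measurable ?P" if "i \<in> {1..n}" for i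
    using that by (rule measurable_component_singleton)
  have "jointly_normal ?N {1..n} (\<lambda>i x. x i)"
    unfolding jointly_normal_def
  proof (intro conjI ballI allI impI)
    fix i assume "i \<in> {1..n}"
    then show "(\<lambda>x. x i) \<in> borel_measurable ?N"
      using comp by simp
  next
    fix K and a :: "nat \<Rightarrow> real" assume K: "finite K \<and> K \<subseteq> {1..n}"
    obtain m s where s: "0 \<le> s" and law: "distr M borel (\<lambda>w. \<Sum>i\<in>K. a i * X i w) = normal_law m s"
      by (rule jointly_normal_lawE[OF J, of K a]) (use K in auto)
    have meas: "(\<lambda>x. \<Sum>i\<in>K. a i * x i) \<in> borel_measurable ?P"
      using K comp by (intro borel_measurable_sum borel_measurable_times) auto
    have measX: "(\<lambda>w. \<Sum>i\<in>K. a i * X i w) \<in> borel_measurable M"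
      using K X by (intro borel_measurable_sum borel_measurable_times) auto
    have "distr ?N borel (\<lambda>x. \<Sum>i\<in>K. a i * x i) = distr M borel (\<lambda>w. \<Sum>i\<in>K. a i * ?T w i)"
      by (subst distr_distr[OF meas T]) (simp add: comp_def)
    also have "(\<lambda>w. \<Sum>i\<in>K. a i * ?T w i) = (\<lambda>w. (\<Sum>i\<in>K. a i * X i w) - (\<Sum>i\<in>K. a i * e i))"
    proof
      fix w
      have "(\<Sum>i\<in>K. a i * ?T w i) = (\<Sum>i\<in>K. a i * X i w - a i * e i)"
        using K by (intro sum.cong) (auto simp: algebra_simps)
      then show "(\<Sum>i\<in>K. a i * ?T w i) = (\<Sum>i\<in>K. a i * X i w) - (\<Sum>i\<in>K. a i * e i)"
        by (simp add: sum_subtractf)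
    qed
    also have "distr M borel \<dots> = distr (distr M borel (\<lambda>w. \<Sum>i\<in>K. a i * X i w)) borel (\<lambda>y. y - (\<Sum>i\<in>K. a i * e i))"
      by (subst distr_distr[OF _ measX]) (auto simp: comp_def)
    also have "\<dots> = normal_law (m - (\<Sum>i\<in>K. a i * e i)) s"
      unfolding law by (rule normal_law_shift[OF s])
    finally show "\<exists>m s. 0 \<le> s \<and> distr ?N borel (\<lambda>x. \<Sum>i\<in>K. a i * x i) = normal_law m s"
      using s by blast
  qed
  moreover have mean: "(LINT x|?N. x i) = 0" if i: "i \<in> {1..n}" for i
  proof -
    have "(LINT x|?N. x i) = (LINT w|M. X i w - e i)"
      using i by (subst integral_distr[OF T comp[OF i]]) auto
    also have "\<dots> = (LINT w|M. X i w) - (LINT w|M. e i)"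
      by (intro Bochner_Integration.integral_diff jointly_normal_integrable[OF J i] integrable_const)
    finally show ?thesis
      using prob_space by (simp add: e_def)
  qed
  moreover have "covariance ?N (\<lambda>x. x i) (\<lambda>x. x j) = covariance M (X i) (X j)"
    if i: "i \<in> {1..n}" and j: "j \<in> {1..n}" for i j
  proof -
    have "covariance ?N (\<lambda>x. x i) (\<lambda>x. x j) = (LINT x|?N. x i * x j)"
      unfolding covariance_def mean[OF i] mean[OF j] by simp
    also have "\<dots> = (LINT w|M. (X i w - e i) * (X j w - e j))"
      using i j by (subst integral_distr[OF T borel_measurable_times[OF comp[OF i] comp[OF j]]]) auto
    finally show ?thesis
      by (simp add: covariance_def e_def)
  qed
  ultimately show ?thesis
    unfolding centered_normal_law_def e_def[symmetric]
    using prob_space_distr[OF T] by simp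
qed

lemma centered_normal_law_marginal:
  assumes L: "centered_normal_law n S N" and i: "i \<in> {1..n}"
  obtains s where "0 \<le> s" "s\<^sup>2 = S i i" "distr N borel (\<lambda>x. x i) = normal_law 0 s"
proof -
  have J: "jointly_normal N {1..n} (\<lambda>i x. x i)" and mean: "(LINT x|N. x i) = 0"
    and cov: "covariance N (\<lambda>x. x i) (\<lambda>x. x i) = S i i"
    using L i by (auto simp: centered_normal_law_def)
  have X: "(\<lambda>x. x i) \<in> borel_measurable N"
    using J i by (simp add: jointly_normal_def)
  obtain m s where s: "0 \<le> s" and law: "distr N borel (\<lambda>x. x i) = normal_law m s"
    by (rule jointly_normal_marginalE[OF J i])
  have m: "m = 0"
    using normal_law_mean[OF X law s] mean by simp
  have "s\<^sup>2 = S i i"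
    using normal_law_variance[OF X law s] cov unfolding covariance_def mean m
    by (simp add: power2_eq_square)
  with that s law m show thesis by blast
qed

text \<open>Joint normality makes the combination normal; its mean vanishes, and its variance comes
  from expanding the square, where the mixed term is integrable because
  \<open>\<bar>a * b\<bar> \<le> a\<^sup>2 + b\<^sup>2\<close>.\<close>

lemma centered_normal_law_diff:
  fixes S :: "nat \<Rightarrow> nat \<Rightarrow> real"
  assumes L: "centered_normal_law n S N" and i: "i \<in> {1..n}" and j: "j \<in> {1..n}" and ij: "i \<noteq> j"
  obtains s where "0 \<le> s" "s\<^sup>2 = S i i - 2 * d * S i j + d\<^sup>2 * S j j"
    "distr N borel (\<lambda>x. x i - d * x j) = normal_law 0 s"
proof -
  have J: "jointly_normal N {1..n} (\<lambda>i x. x i)"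
    and mean: "(LINT x|N. x i) = 0" "(LINT x|N. x j) = 0"
    and cov: "covariance N (\<lambda>x. x i) (\<lambda>x. x j) = S i j" "covariance N (\<lambda>x. x i) (\<lambda>x. x i) = S i i"
      "covariance N (\<lambda>x. x j) (\<lambda>x. x j) = S j j"
    using L i j by (auto simp: centered_normal_law_def)
  have [measurable]: "(\<lambda>x. x i) \<in> borel_measurable N" "(\<lambda>x. x j) \<in> borel_measurable N"
    using J i j by (auto simp: jointly_normal_def)
  note int = jointly_normal_integrable[OF J i] jointly_normal_integrable[OF J j]
  note int2 = jointly_normal_integrable_square[OF J i] jointly_normal_integrable_square[OF J j]
  have intm: "integrable N (\<lambda>x. x i * x j)"
  proof (rule Bochner_Integration.integrable_bound[OF Bochner_Integration.integrable_add[OF int2]])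
    have "\<bar>a * b\<bar> \<le> a\<^sup>2 + b\<^sup>2" for a b :: real
      using sum_squares_bound[of "\<bar>a\<bar>" "\<bar>b\<bar>"] abs_ge_zero[of "a * b"]
      unfolding abs_mult power2_abs by linarith
    then show "AE x in N. norm (x i * x j) \<le> norm ((x i)\<^sup>2 + (x j)\<^sup>2)"
      by auto
  qed simp
  \<comment> \<open>The sum runs over a set, so \<open>i \<noteq> j\<close> is what makes it have
    two separate terms.\<close>
  obtain m s where s: "0 \<le> s"
    and law: "distr N borel (\<lambda>x. \<Sum>l\<in>{i, j}. (if l = i then 1 else - d) * x l) = normal_law m s"
    by (rule jointly_normal_lawE[OF J, where J = "{i, j}" and a = "\<lambda>l. if l = i then 1 else - d"])
      (use i j in auto)
  then have law: "distr N borel (\<lambda>x. x i - d * x j) = normal_law m s"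
    using ij by simp
  have "m = (LINT x|N. x i - d * x j)"
    using normal_law_mean[OF _ law s] by simp
  also have "\<dots> = (LINT x|N. x i) - (LINT x|N. d * x j)"
    by (intro Bochner_Integration.integral_diff int integrable_mult_right)
  finally have m: "m = 0"
    using mean by simp
  have "s\<^sup>2 = (LINT x|N. (x i - d * x j)\<^sup>2)"
    using normal_law_variance[OF _ law s] m by simp
  also have "\<dots> = (LINT x|N. (x i)\<^sup>2 - (2 * d) * (x i * x j) + d\<^sup>2 * (x j)\<^sup>2)"
    by (intro Bochner_Integration.integral_cong refl)
       (simp add: power2_diff power_mult_distrib mult_ac)
  also have "\<dots> = (LINT x|N. (x i)\<^sup>2 - (2 * d) * (x i * x j)) + (LINT x|N. d\<^sup>2 * (x j)\<^sup>2)"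
    by (intro Bochner_Integration.integral_add Bochner_Integration.integrable_diff int2 intm integrable_mult_right)
  also have "(LINT x|N. (x i)\<^sup>2 - (2 * d) * (x i * x j)) = (LINT x|N. (x i)\<^sup>2) - (LINT x|N. (2 * d) * (x i * x j))"
    by (intro Bochner_Integration.integral_diff int2 intm integrable_mult_right)
  finally have "s\<^sup>2 = S i i - 2 * d * S i j + d\<^sup>2 * S j j"
    using cov unfolding covariance_def mean by (simp add: power2_eq_square)
  with that s law m show thesis by blast
qed

text \<open>The index \<open>p\<close> is the pivot shared by all differences. Coordinates up to
  \<open>p\<close> get a crude union bound, harmless for fixed \<open>p\<close>. For
  \<open>i > p\<close> the difference has standard deviation at most
  \<open>t * (1 - \<eta>)\<close>, so dividing the level \<open>(1 - \<eta>) * c\<close> by it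
  leaves \<open>c / t\<close>. With \<open>t < 1\<close> this lies beyond \<open>c\<close> by a
  fixed factor.\<close>

lemma centered_normal_law_max_le:
  fixes S :: "nat \<Rightarrow> nat \<Rightarrow> real"
  assumes L: "centered_normal_law n S N"
    and var: "\<And>i. i \<in> {1..n} \<Longrightarrow> S i i = 1"
    and p: "p \<in> {1..n}" and cov: "\<And>i. i \<in> {p<..n} \<Longrightarrow> d \<le> S i p"
    and d: "0 < d" and \<eta>: "0 \<le> \<eta>" "\<eta> < 1" and t: "0 < t" "1 - d\<^sup>2 \<le> (t * (1 - \<eta>))\<^sup>2"
    and c: "0 \<le> c"
  shows "measure N {x \<in> space N. \<exists>i\<in>{1..n}. c < x i}
    \<le> real p * normal_tail c + normal_tail (\<eta> * c / d) + real n * normal_tail (c / t)"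
proof -
  interpret prob_space N
    using L by (simp add: centered_normal_law_def)
  have meas: "(\<lambda>x. x i) \<in> borel_measurable N" if "i \<in> {1..n}" for i
    using L that by (auto simp: centered_normal_law_def jointly_normal_def)
  define A where "A i = {x \<in> space N. c < x i}" for i
  define B where "B = {x \<in> space N. \<eta> * c / d < x p}"
  define D where "D i = {x \<in> space N. (1 - \<eta>) * c < x i - d * x p}" for i
  have A_sets: "A i \<in> events" if "i \<in> {1..n}" for i
    unfolding A_def using meas[OF that] by measurable
  have B_sets: "B \<in> events"
    unfolding B_def using meas[OF p] by measurable
  have D_meas: "(\<lambda>x. x i - d * x p) \<in> borel_measurable N" if "i \<in> {p<..n}" for i
    by (intro borel_measurable_diff borel_measurable_times borel_measurable_const meas p)
       (use that in auto)
  have D_sets: "D i \<in> events" if "i \<in> {p<..n}" for i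
    unfolding D_def using D_meas[OF that] by measurable
  have marginal: "prob {x \<in> space N. b < x i} \<le> normal_tail b" if i: "i \<in> {1..n}" and b: "0 \<le> b" for i b
  proof -
    obtain s where s: "0 \<le> s" "s\<^sup>2 = S i i" and law: "distr N borel (\<lambda>x. x i) = normal_law 0 s"
      by (rule centered_normal_law_marginal[OF L i])
    have "s \<le> 1"
      using s var[OF i] by (simp add: power2_eq_1_iff)
    then show ?thesis
      using normal_law_prob_gt_le[OF prob_space_axioms meas[OF i] law s(1) _ _ b, of 1] by simp
  qed
  have D_prob: "prob (D i) \<le> normal_tail (c / t)" if i: "i \<in> {p<..n}" for i
  proof -
    have i': "i \<in> {1..n}" "i \<noteq> p" using i by auto
    obtain s where s: "0 \<le> s" "s\<^sup>2 = S i i - 2 * d * S i p + d\<^sup>2 * S p p"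
      and law: "distr N borel (\<lambda>x. x i - d * x p) = normal_law 0 s"
      by (rule centered_normal_law_diff[OF L i'(1) p i'(2)])
    have "d * d \<le> d * S i p"
      using cov[OF i] d by simp
    then have "s\<^sup>2 \<le> 1 - d\<^sup>2"
      using s(2) var[OF i'(1)] var[OF p] by (simp add: power2_eq_square)
    with t(2) have "s\<^sup>2 \<le> (t * (1 - \<eta>))\<^sup>2" by simp
    then have "s \<le> t * (1 - \<eta>)"
      by (rule power2_le_imp_le) (use t \<eta> in simp)
    then have "prob (D i) \<le> normal_tail ((1 - \<eta>) * c / (t * (1 - \<eta>)))"
      unfolding D_def
      by (intro normal_law_prob_gt_le[OF prob_space_axioms D_meas[OF i] law s(1)])
         (use t \<eta> c in auto)
    also have "(1 - \<eta>) * c / (t * (1 - \<eta>)) = c / t"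
      using \<eta> by simp
    finally show ?thesis .
  qed
  have "{x \<in> space N. \<exists>i\<in>{1..n}. c < x i} \<subseteq> (\<Union>i\<in>{1..p}. A i) \<union> B \<union> (\<Union>i\<in>{p<..n}. D i)"
  proof
    fix x assume "x \<in> {x \<in> space N. \<exists>i\<in>{1..n}. c < x i}"
    then obtain i where x: "x \<in> space N" and i: "i \<in> {1..n}" "c < x i" by auto
    show "x \<in> (\<Union>i\<in>{1..p}. A i) \<union> B \<union> (\<Union>i\<in>{p<..n}. D i)"
    proof (cases "i \<le> p \<or> x \<in> B")
      case True
      then show ?thesis using x i by (auto simp: A_def)
    next
      case False
      then have "d * x p \<le> \<eta> * c"
        using x d by (simp add: B_def field_simps)
      with i(2) have "(1 - \<eta>) * c < x i - d * x p"
        by (simp add: algebra_simps)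
      then have "x \<in> D i"
        using x by (simp add: D_def)
      then show ?thesis using False i by auto
    qed
  qed
  then have "prob {x \<in> space N. \<exists>i\<in>{1..n}. c < x i} \<le> prob ((\<Union>i\<in>{1..p}. A i) \<union> B \<union> (\<Union>i\<in>{p<..n}. D i))"
    using A_sets B_sets D_sets p by (intro finite_measure_mono sets.Un sets.finite_UN) auto
  also have "\<dots> \<le> prob ((\<Union>i\<in>{1..p}. A i) \<union> B) + prob (\<Union>i\<in>{p<..n}. D i)"
    using A_sets B_sets D_sets p by (intro measure_Un_le sets.Un sets.finite_UN) auto
  also have "\<dots> \<le> prob (\<Union>i\<in>{1..p}. A i) + prob B + prob (\<Union>i\<in>{p<..n}. D i)"
    using A_sets B_sets p by (intro add_right_mono measure_Un_le sets.finite_UN) auto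
  also have "\<dots> \<le> (\<Sum>i\<in>{1..p}. prob (A i)) + prob B + (\<Sum>i\<in>{p<..n}. prob (D i))"
    using A_sets D_sets p by (intro add_mono finite_measure_subadditive_finite order_refl) auto
  also have "\<dots> \<le> (\<Sum>i\<in>{1..p}. normal_tail c) + normal_tail (\<eta> * c / d) + (\<Sum>i\<in>{p<..n}. normal_tail (c / t))"
    unfolding A_def B_def using p c \<eta> d by (intro add_mono sum_mono marginal D_prob) auto
  \<comment> \<open>The last sum has only \<open>n - p\<close> terms; positivity of the tail allows
    \<open>n\<close> instead.\<close>
  also have "\<dots> \<le> real p * normal_tail c + normal_tail (\<eta> * c / d) + real n * normal_tail (c / t)"
    using less_imp_le[OF normal_tail_pos[of "c / t"]] by (simp add: mult_right_mono)
  finally show ?thesis .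
qed

section \<open>Divergence of the thresholds and the limit\<close>

lemma normal_quantile_at_top:
  assumes q: "0 < q"
  shows "filterlim (\<lambda>n. inv Phi (1 - q / real n)) at_top sequentially"
proof -
  have lim: "(\<lambda>n. q / real n) \<longlonglongrightarrow> 0"
    by (rule lim_const_over_n)
  show ?thesis
    unfolding filterlim_at_top
  proof
    fix Z
    \<comment> \<open>The last two conditions put \<open>1 - q / n\<close> strictly between 0 and 1,
      where \<open>Phi_inv\<close> applies; \<open>n > 0\<close> is listed because
      \<open>q / 0 = 0\<close>. The threshold then has tail \<open>q / n\<close>, and since tails
      are antitone the first condition keeps it from lying below \<open>Z\<close>.\<close>
    have "eventually (\<lambda>n. q / real n < normal_tail Z \<and> q / real n < 1 \<and> n > 0) sequentially"
      by (intro eventually_conj order_tendstoD(2)[OF lim normal_tail_pos]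
          order_tendstoD(2)[OF lim zero_less_one] eventually_gt_at_top)
    then show "eventually (\<lambda>n. Z \<le> inv Phi (1 - q / real n)) sequentially"
    proof eventually_elim
      case (elim n)
      then have "normal_tail (inv Phi (1 - q / real n)) = q / real n"
        using q unfolding normal_tail_eq by (subst Phi_inv) auto
      then show ?case
        using elim normal_tail_antimono[of "inv Phi (1 - q / real n)" Z] by fastforce
    qed
  qed
qed

theorem corollary4p1:
  fixes M :: "'a measure" and X :: "nat \<Rightarrow> 'a \<Rightarrow> real"
    and \<mu> :: "nat \<Rightarrow> real" and \<rho> :: "nat \<Rightarrow> nat \<Rightarrow> real"
    and \<delta> \<alpha> :: real and k :: nat
  assumes "prob_space M"
    and "jointly_normal M {1..} X"
    and "\<And>i. 1 \<le> i \<Longrightarrow> distributed M lborel (X i) (\<lambda>x. ennreal (normal_density (\<mu> i) 1 x))"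
    and "\<And>i j. 1 \<le> i \<Longrightarrow> 1 \<le> j \<Longrightarrow> i \<noteq> j \<Longrightarrow> correlation M (X i) (X j) = \<rho> i j"
    and "\<And>i j. 1 \<le> i \<Longrightarrow> 1 \<le> j \<Longrightarrow> i \<noteq> j \<Longrightarrow> \<rho> i j \<in> {0<..1}"
    and "(\<lambda>N. Inf {\<rho> i j | i j. N \<le> i \<and> N \<le> j \<and> i \<noteq> j}) \<longlonglongrightarrow> \<delta>"
    and "\<delta> > 0"
    and "\<alpha> \<in> {0<..<1}"
    and "k > 0"
    and "real k * \<alpha> < 1"
  shows "(\<lambda>n. kFWER k n \<alpha> (\<lambda>i j. correlation M (X i) (X j))) \<longlonglongrightarrow> 0"
proof -
  interpret prob_space M by fact
  define S where "S = (\<lambda>i j. correlation M (X i) (X j))"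
  define q where "q = real k * \<alpha>"
  have q: "0 < q" "q < 1"
    using assms(8,9,10) by (auto simp: q_def)
  have cov_self: "covariance M (X i) (X i) = 1" if i: "1 \<le> i" for i
  proof -
    have X: "X i \<in> borel_measurable M"
      using assms(2) i by (simp add: jointly_normal_def)
    have "distr M borel (X i) = distr M lborel (X i)"
      by (rule distr_cong) auto
    also have "\<dots> = normal_law (\<mu> i) 1"
      using assms(3)[OF i] by (simp add: distributed_def normal_law_def)
    finally have law: "distr M borel (X i) = normal_law (\<mu> i) 1" .
    show ?thesis
      using normal_law_variance[OF X law] normal_law_mean[OF X law]
      by (simp add: covariance_def power2_eq_square)
  qed
  then have S_self: "S i i = 1" if "1 \<le> i" for i
    using that by (simp add: S_def correlation_def)
  have S_cov: "S i j = covariance M (X i) (X j)" if "1 \<le> i" "1 \<le> j" for i j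
    using that by (simp add: S_def correlation_def cov_self)
  \<comment> \<open>All variances are 1, so \<open>S\<close> agrees on \<open>{1..n}\<close> with
    the covariance matrix of the given variables. Their centered law shows that the choice in
    \<open>mvn0\<close> succeeds; only the defining predicate of the chosen law is used
    afterwards.\<close>
  have law: "centered_normal_law n S (mvn0 n S)" for n
  proof -
    have "jointly_normal M {1..n} X"
      using assms(2) by (rule jointly_normal_subset) auto
    from centered_normal_law_distr[OF assms(1) this] obtain N
      where "centered_normal_law n (\<lambda>i j. covariance M (X i) (X j)) N" by blast
    then have "centered_normal_law n S N"
      unfolding centered_normal_law_def using S_cov by simp
    then show ?thesis
      unfolding mvn0_def by (rule someI)
  qed
  \<comment> \<open>Any number strictly between 0 and \<open>\<delta>\<close> would serve.\<close>
  define d where "d = \<delta> / 2"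
  have d: "0 < d" "d < \<delta>"
    using assms(7) by (auto simp: d_def)
  obtain p where p: "1 \<le> p" "d < Inf {\<rho> i j | i j. p \<le> i \<and> p \<le> j \<and> i \<noteq> j}"
    using eventually_happens'[OF sequentially_bot
        eventually_conj[OF eventually_ge_at_top[of 1] order_tendstoD(1)[OF assms(6) d(2)]]] by auto
  have \<rho>: "d < \<rho> i j" if "p \<le> i" "p \<le> j" "i \<noteq> j" for i j
  proof -
    \<comment> \<open>A real \<open>Inf\<close> is known to be a lower bound only when the set is
      bounded below; positivity of the correlations provides the bound 0.\<close>
    have "bdd_below {\<rho> i j | i j. p \<le> i \<and> p \<le> j \<and> i \<noteq> j}"
    proof (rule bdd_belowI)
      fix r assume "r \<in> {\<rho> i j | i j. p \<le> i \<and> p \<le> j \<and> i \<noteq> j}"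
      then obtain i j where r: "r = \<rho> i j" and ij: "p \<le> i" "p \<le> j" "i \<noteq> j" by blast
      show "0 \<le> r"
        using assms(5)[OF order_trans[OF p(1) ij(1)] order_trans[OF p(1) ij(2)] ij(3)]
        unfolding r by simp
    qed
    moreover have "\<rho> i j \<in> {\<rho> i j | i j. p \<le> i \<and> p \<le> j \<and> i \<noteq> j}"
      using that by blast
    ultimately have "Inf {\<rho> i j | i j. p \<le> i \<and> p \<le> j \<and> i \<noteq> j} \<le> \<rho> i j"
      by (intro cInf_lower)
    with p(2) show ?thesis by simp
  qed
  have "d < 1"
    using \<rho>[of p "Suc p"] assms(5)[of p "Suc p"] p(1) by simp
  \<comment> \<open>With \<open>\<eta> = 1 - t\<close> this choice makes \<open>t * (1 - \<eta>)\<close> the standard deviation bound \<open>sqrt (1 - d\<^sup>2)\<close>.\<close>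
  define t where "t = sqrt (sqrt (1 - d\<^sup>2))"
  have d2: "0 < d\<^sup>2" "d\<^sup>2 < 1"
    using d \<open>d < 1\<close> by (auto simp: power_less_one_iff)
  then have t: "0 < t" "t < 1" "1 - d\<^sup>2 = (t * (1 - (1 - t)))\<^sup>2"
    by (auto simp: t_def)
  define c where "c n = inv Phi (1 - q / real n)" for n :: nat
  have c_top: "filterlim c at_top sequentially"
    unfolding c_def by (rule normal_quantile_at_top[OF q(1)])
  \<comment> \<open>The bound depends on \<open>n\<close> only through the threshold. The last term
    is the tail comparison with \<open>r = 1 / t\<close>, in which
    \<open>n * normal_tail (c n)\<close> has been replaced by its constant value
    \<open>q\<close>.\<close>
  define U where "U x = real p * normal_tail x + normal_tail ((1 - t) / d * x)
    + q / t * exp (- ((1 / t)\<^sup>2 - 1) / 2 * x\<^sup>2)" for x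
  have le: "eventually (\<lambda>n. kFWER k n \<alpha> S \<le> U (c n)) sequentially"
    using eventually_ge_at_top[of p] filterlim_at_top[THEN iffD1, OF c_top, rule_format, of 0]
  proof eventually_elim
    case (elim n)
    let ?N = "mvn0 n S"
    interpret N: prob_space ?N
      using law[of n] by (simp add: centered_normal_law_def)
    have n: "0 < n" using elim p by simp
    \<comment> \<open>From \<open>q < 1\<close> and \<open>n \<ge> 1\<close> it follows that
      \<open>1 - q / n\<close> is strictly between 0 and 1, so the quantile is genuine.\<close>
    have "normal_tail (c n) = q / real n"
      using q n unfolding normal_tail_eq c_def by (subst Phi_inv) auto
    then have tail: "real n * normal_tail (c n) = q"
      using n by simp
    have meas: "(\<lambda>x. x i) \<in> borel_measurable ?N" if "i \<in> {1..n}" for i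
      using law[of n] that by (auto simp: centered_normal_law_def jointly_normal_def)
    have "kFWER k n \<alpha> S \<le> measure ?N {x \<in> space ?N. \<exists>i\<in>{1..n}. c n < x i}"
      unfolding kFWER_def
    proof (rule N.finite_measure_mono)
      show "{x \<in> space ?N. k \<le> card {i \<in> {1..n}. x i > inv Phi (1 - real k * \<alpha> / real n)}}
        \<subseteq> {x \<in> space ?N. \<exists>i\<in>{1..n}. c n < x i}"
      proof clarsimp
        fix x assume "k \<le> card {i. Suc 0 \<le> i \<and> i \<le> n \<and> inv Phi (1 - real k * \<alpha> / real n) < x i}"
        with \<open>k > 0\<close> have "{i. Suc 0 \<le> i \<and> i \<le> n \<and> inv Phi (1 - real k * \<alpha> / real n) < x i} \<noteq> {}"
          by (metis card.empty not_le)
        then show "\<exists>i\<in>{Suc 0..n}. c n < x i"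
          by (auto simp: c_def q_def)
      qed
      show "{x \<in> space ?N. \<exists>i\<in>{1..n}. c n < x i} \<in> N.events"
        by (intro sets.sets_Collect_finite_Ex borel_measurable_less meas) auto
    qed
    also have "\<dots> \<le> real p * normal_tail (c n) + normal_tail ((1 - t) * c n / d) + real n * normal_tail (c n / t)"
    proof (rule centered_normal_law_max_le[OF law])
      show "d \<le> S i p" if "i \<in> {p<..n}" for i
        using \<rho>[of i p] assms(4)[of i p] that p(1) by (simp add: S_def)
    qed (use elim p d t S_self in auto)
    also have "real n * normal_tail (c n / t) \<le> q / t * exp (- ((1 / t)\<^sup>2 - 1) / 2 * (c n)\<^sup>2)"
    proof -
      have "real n * normal_tail (1 / t * c n)
          \<le> real n * (1 / t * exp (- ((1 / t)\<^sup>2 - 1) * (c n)\<^sup>2 / 2) * normal_tail (c n))"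
        using t elim by (intro mult_left_mono normal_tail_scale_le) auto
      also have "\<dots> = (real n * normal_tail (c n)) / t * exp (- ((1 / t)\<^sup>2 - 1) * (c n)\<^sup>2 / 2)"
        by simp
      finally show ?thesis
        unfolding tail by simp
    qed
    finally show ?case
      unfolding U_def by simp
  qed
  \<comment> \<open>The first two terms are tails at points going to infinity, as
    \<open>t < 1\<close> and \<open>d > 0\<close>. In the third, \<open>1 / t > 1\<close> makes the
    exponent tend to minus infinity.\<close>
  have "(U \<longlongrightarrow> 0) at_top"
  proof -
    have "filterlim (\<lambda>x. (1 - t) / d * x) at_top at_top"
      using t d by (intro filterlim_tendsto_pos_mult_at_top[OF tendsto_const] filterlim_ident) auto
    then have l1: "((\<lambda>x. normal_tail ((1 - t) / d * x)) \<longlongrightarrow> 0) at_top"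
      by (rule filterlim_compose[OF normal_tail_tendsto_0])
    have "- ((1 / t)\<^sup>2 - 1) / 2 < 0"
      using t one_less_power[of "1 / t" 2] by simp
    then have "filterlim (\<lambda>x::real. - ((1 / t)\<^sup>2 - 1) / 2 * x\<^sup>2) at_bot at_top"
      by (intro filterlim_tendsto_neg_mult_at_bot[OF tendsto_const] filterlim_pow_at_top filterlim_ident) auto
    then have l2: "((\<lambda>x::real. exp (- ((1 / t)\<^sup>2 - 1) / 2 * x\<^sup>2)) \<longlongrightarrow> 0) at_top"
      by (rule filterlim_compose[OF exp_at_bot])
    show ?thesis
      unfolding U_def
      using tendsto_add[OF tendsto_add[OF tendsto_mult_left[OF normal_tail_tendsto_0, of "real p"] l1]
          tendsto_mult_left[OF l2, of "q / t"]] by simp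
  qed
  then have "(\<lambda>n. U (c n)) \<longlonglongrightarrow> 0"
    using c_top by (rule filterlim_compose)
  then have "(\<lambda>n. kFWER k n \<alpha> S) \<longlonglongrightarrow> 0"
    by (rule tendsto_sandwich[OF _ le tendsto_const, rotated]) (simp add: kFWER_def)
  then show ?thesis
    by (simp add: S_def)
qed

end
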